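(* Let $\alpha\in(0,1)$ and $\mathcal{B}_{W^{\alpha,1}}:=\{u\in W^{\alpha,1}(\mathbb{R}^d): |u|_{W^{\alpha,1}(\mathbb{R}^d)}\le1\}$. Then the set of its extreme points is $$\operatorname{Ext}(\mathcal{B}_{W^{\alpha,1}})=\left\{\pm\frac{\mathbf{1}_E}{\mathbb{P}_\alpha(E)}\ \middle|\ E\subset\mathbb{R}^d,\ |E|\in(0,\infty)\text{ and }\mathbb{P}_\alpha(E)\in(0,\infty)\right\}.$$
   Context: $|u|_{W^{\alpha,1}(\mathbb{R}^d)}:=\int_{\mathbb{R}^d}\int_{\mathbb{R}^d}\frac{|u(x)-u(y)|}{|x-y|^{d+\alpha}}\,dx\,dy$; $W^{\alpha,1}(\mathbb{R}^d)$ is the space of $u\in L^1(\mathbb{R}^d)$ for which this is finite (functions identified a.e.); and $\mathbb{P}_\alpha(E):=|\mathbf{1}_E|_{W^{\alpha,1}(\mathbb{R}^d)}$ for measurable $E$. *)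

theory Defs
  imports "HOL-Analysis.Analysis"
begin

definition L1_rel :: "('a::euclidean_space \<Rightarrow> real) \<Rightarrow> ('a \<Rightarrow> real) \<Rightarrow> bool" where
  "L1_rel f g \<longleftrightarrow>
     integrable lebesgue f \<and> integrable lebesgue g \<and> (AE x in lebesgue. f x = g x)"

text \<open>
  The vector space of Lebesgue integrable functions, identified almost everywhere. The quotient
  is partial: \<open>abs_L1 f\<close> is meaningful only for integrable \<open>f\<close>.
\<close>

quotient_type (overloaded) 'a L1 = "'a::euclidean_space \<Rightarrow> real" / partial: L1_rel
proof (rule part_equivpI)
  have "L1_rel (\<lambda>x::'a. 0) (\<lambda>x. 0)"
    by (simp add: L1_rel_def)
  then show "\<exists>f::'a \<Rightarrow> real. L1_rel f f" by blast
  show "symp (L1_rel :: ('a \<Rightarrow> real) \<Rightarrow> _)"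
    by (auto intro!: sympI simp: L1_rel_def eq_commute)
  show "transp (L1_rel :: ('a \<Rightarrow> real) \<Rightarrow> _)"
  proof (rule transpI)
    fix f g h :: "'a \<Rightarrow> real"
    assume fg: "L1_rel f g" and gh: "L1_rel g h"
    have "AE x in lebesgue. f x = g x" "AE x in lebesgue. g x = h x"
      using fg gh by (auto simp: L1_rel_def)
    then have "AE x in lebesgue. f x = h x"
      by eventually_elim simp
    then show "L1_rel f h"
      using fg gh by (simp add: L1_rel_def)
  qed
qed

instantiation L1 :: (euclidean_space) real_vector
begin

lift_definition zero_L1 :: "'a L1" is "\<lambda>x. 0"
  by (simp add: L1_rel_def)

lift_definition plus_L1 :: "'a L1 \<Rightarrow> 'a L1 \<Rightarrow> 'a L1" is "\<lambda>f g x. f x + g x"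
  by (auto simp: L1_rel_def elim: eventually_elim2)

lift_definition minus_L1 :: "'a L1 \<Rightarrow> 'a L1 \<Rightarrow> 'a L1" is "\<lambda>f g x. f x - g x"
  by (auto simp: L1_rel_def elim: eventually_elim2)

lift_definition uminus_L1 :: "'a L1 \<Rightarrow> 'a L1" is "\<lambda>f x. - f x"
  by (auto simp: L1_rel_def)

lift_definition scaleR_L1 :: "real \<Rightarrow> 'a L1 \<Rightarrow> 'a L1" is "\<lambda>c f x. c * f x"
  by (auto simp: L1_rel_def)

instance
  by standard (transfer; auto simp: L1_rel_def algebra_simps)+

end

text \<open>
  The double integral is extended-valued. On the diagonal the integrand is \<open>0 / 0 = 0\<close>; the
  diagonal is a null set.
\<close>

definition gagliardo :: "real \<Rightarrow> ('a::euclidean_space \<Rightarrow> real) \<Rightarrow> ennreal" where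
  "gagliardo \<alpha> u =
     (\<integral>\<^sup>+ y. \<integral>\<^sup>+ x. ennreal (\<bar>u x - u y\<bar> / norm (x - y) powr (real DIM('a) + \<alpha>)) \<partial>lebesgue \<partial>lebesgue)"

lemma gagliardo_cong_AE:
  assumes "AE x in lebesgue. u x = v x"
  shows "gagliardo \<alpha> u = gagliardo \<alpha> v"
  unfolding gagliardo_def
proof (rule nn_integral_cong_AE)
  show "AE y in lebesgue.
      (\<integral>\<^sup>+ x. ennreal (\<bar>u x - u y\<bar> / norm (x - y) powr (real DIM('a) + \<alpha>)) \<partial>lebesgue) =
      (\<integral>\<^sup>+ x. ennreal (\<bar>v x - v y\<bar> / norm (x - y) powr (real DIM('a) + \<alpha>)) \<partial>lebesgue)"
    using assms
  proof eventually_elim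
    case (elim y)
    show ?case
      by (rule nn_integral_cong_AE, use assms in eventually_elim) (simp add: elim)
  qed
qed

lift_definition W_seminorm :: "real \<Rightarrow> 'a::euclidean_space L1 \<Rightarrow> ennreal" is gagliardo
  by (auto simp: L1_rel_def intro: gagliardo_cong_AE)

definition W_space :: "real \<Rightarrow> 'a::euclidean_space L1 set" where
  "W_space \<alpha> = {u. W_seminorm \<alpha> u < \<infinity>}"

definition W_ball :: "real \<Rightarrow> 'a::euclidean_space L1 set" where
  "W_ball \<alpha> = {u \<in> W_space \<alpha>. W_seminorm \<alpha> u \<le> 1}"

definition frac_perimeter :: "real \<Rightarrow> 'a::euclidean_space set \<Rightarrow> ennreal" where
  "frac_perimeter \<alpha> E = gagliardo \<alpha> (indicator E)"

end

theory Submission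
  imports Defs
begin

text \<open>
  The proof rests on one fact about the integrand of the seminorm: if \<open>u = v + w\<close> and the
  increments of \<open>v\<close> and \<open>w\<close> between any two points have the same sign, then
  \<open>\<bar>u x - u y\<bar> = \<bar>v x - v y\<bar> + \<bar>w x - w y\<bar>\<close>, and the seminorms add up exactly.

  Let \<open>u\<close> be an extreme point. Its seminorm is \<open>1\<close>: a nonzero \<open>u\<close> of smaller seminorm lies
  strictly between \<open>0\<close> and its normalization, and \<open>0\<close> is the midpoint of \<open>v\<close> and \<open>- v\<close> for any
  nonzero \<open>v\<close> of the ball. Such a \<open>v\<close> exists because the singularity of the kernel is integrable
  against Lipschitz increments when \<open>\<alpha> < 1\<close>, and its tail is integrable when \<open>0 < \<alpha>\<close>
  (\<open>gagliardo_tent_finite\<close>). If now \<open>u = v + w\<close> with nonzero \<open>v\<close> and \<open>w\<close> whose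
  seminorms add up to \<open>1\<close>, then \<open>u\<close> is a convex combination of their normalizations, so \<open>v\<close> is a multiple of \<open>u\<close>
  (\<open>extreme_point_summand\<close>). Cutting \<open>u\<close> at a height \<open>s\<close> gives such a decomposition,
  with the part of the graph below \<open>s\<close> and the part above \<open>s\<close> as summands. If \<open>u\<close> took two
  different nonzero values, a rational \<open>s\<close> between them would give a lower part that is not
  proportional to \<open>u\<close>. Hence \<open>u\<close> has a single nonzero value \<open>c\<close>
  (\<open>extreme_point_single_level\<close>), and the seminorm being \<open>1\<close> forces
  \<open>\<bar>c\<bar>\<close> to be the reciprocal of the perimeter.

  Conversely, let \<open>u\<close> be a normalized indicator of \<open>E\<close> and a proper convex combination of \<open>v\<close>
  and \<open>w\<close> in the ball. The triangle inequality for the seminorm is then an equality, hence it is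
  an equality of integrands almost everywhere (\<open>gagliardo_triangle_equality\<close>). So \<open>v\<close> and \<open>w\<close>
  do not jump where \<open>u\<close> does not jump: they are constant on \<open>E\<close> and off \<open>E\<close>. The constant off \<open>E\<close>
  is \<open>0\<close> by integrability, so both are multiples of \<open>u\<close>, with factors that are at most \<open>1\<close> and
  average to \<open>1\<close>; thus \<open>v = u = w\<close>.
\<close>

section \<open>Integrable functions modulo null sets\<close>

lemma L1_rel_refl_iff: "L1_rel f f \<longleftrightarrow> integrable lebesgue f"
  by (simp add: L1_rel_def)

lemma abs_L1_eq_iff:
  assumes "integrable lebesgue f" "integrable lebesgue g"
  shows "abs_L1 f = abs_L1 g \<longleftrightarrow> (AE x in lebesgue. f x = g x)"
  using Quotient_rel[OF Quotient_L1, of f g] assms by (simp add: L1_rel_def)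

lemma abs_L1_add:
  assumes "integrable lebesgue f" "integrable lebesgue g"
  shows "abs_L1 (\<lambda>x. f x + g x) = abs_L1 f + abs_L1 g"
  using assms by (simp add: plus_L1.abs_eq L1_rel_refl_iff)

lemma abs_L1_scaleR:
  assumes "integrable lebesgue f"
  shows "abs_L1 (\<lambda>x. c * f x) = c *\<^sub>R abs_L1 f"
  using assms by (simp add: scaleR_L1.abs_eq L1_rel_refl_iff)

lemma W_seminorm_abs_L1:
  assumes "integrable lebesgue f"
  shows "W_seminorm \<alpha> (abs_L1 f) = gagliardo \<alpha> f"
  using assms by (simp add: W_seminorm.abs_eq L1_rel_refl_iff)

text \<open>
  For a Borel representative the integrand of the seminorm is a Borel function of the pair of
  points, so that the iterated integral is an integral over the product of \<open>lborel\<close> with itself.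
\<close>

lemma L1_borel_representative:
  fixes u :: "'a::euclidean_space L1"
  obtains f where "f \<in> borel_measurable borel" "integrable lebesgue f" "u = abs_L1 f"
proof -
  define g where "g = rep_L1 u"
  have g: "integrable lebesgue g"
    unfolding g_def using Quotient_rep_reflp[OF Quotient_L1, of u] by (simp add: L1_rel_def)
  have u: "u = abs_L1 g"
    unfolding g_def by (simp add: Quotient_abs_rep[OF Quotient_L1])
  obtain f where f: "f \<in> borel_measurable lborel" and eq: "AE x in lborel. g x = f x"
    using completion_ex_borel_measurable_real[of g lborel] g by blast
  have eq': "AE x in lebesgue. g x = f x"
    using eq by (rule AE_completion)
  have fi: "integrable lebesgue f"
  proof (rule integrable_cong_AE_imp[OF g])
    show "f \<in> borel_measurable lebesgue"
      using f by (rule measurable_completion)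
    show "AE x in lebesgue. g x = f x"
      by (rule eq')
  qed
  show ?thesis
    using that[of f] f fi g eq' u by (simp add: abs_L1_eq_iff)
qed

lemma emeasure_lebesgue_Compl_eq_top:
  fixes E :: "'a::euclidean_space set"
  assumes E: "E \<in> sets lebesgue" "emeasure lebesgue E < \<infinity>"
  shows "emeasure lebesgue (- E) = \<infinity>"
proof -
  have "emeasure lebesgue (UNIV :: 'a set) = \<infinity>"
    by (simp add: emeasure_lborel_UNIV)
  then show ?thesis
    using emeasure_compl[OF E(1)] E(2)
    by (simp add: Compl_eq_Diff_UNIV del: emeasure_completion)
qed

text \<open>
  The complement of \<open>E\<close> has infinite measure, so a nonzero constant is not integrable there.
\<close>

lemma integrable_const_off_finite_measure_eq_0:
  fixes f :: "'a::euclidean_space \<Rightarrow> real"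
  assumes f: "integrable lebesgue f"
    and E: "E \<in> sets lebesgue" "emeasure lebesgue E < \<infinity>"
    and const: "AE x in lebesgue. x \<notin> E \<longrightarrow> f x = d"
  shows "d = 0"
proof (rule ccontr)
  assume d: "d \<noteq> 0"
  have "ennreal \<bar>d\<bar> * emeasure lebesgue (- E)
      = (\<integral>\<^sup>+x. ennreal \<bar>d\<bar> * indicator (- E) x \<partial>lebesgue)"
    using E(1) sets.compl_sets[OF E(1)]
    by (subst nn_integral_cmult_indicator) (auto simp: Compl_eq_Diff_UNIV)
  also have "\<dots> \<le> (\<integral>\<^sup>+x. ennreal (norm (f x)) \<partial>lebesgue)"
    by (rule nn_integral_mono_AE, use const in eventually_elim) (auto simp: indicator_def)
  also have "\<dots> < \<infinity>"
    using f by (simp add: integrable_iff_bounded)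
  finally show False
    using d emeasure_lebesgue_Compl_eq_top[OF E] by (simp add: ennreal_mult_top)
qed

lemma ex_in_pos_measure_if_AE:
  assumes "E \<in> sets M" "0 < emeasure M E" "AE x in M. P x"
  shows "\<exists>x\<in>E. P x"
proof (rule ccontr)
  assume "\<not> ?thesis"
  then have "AE x in M. x \<notin> E"
    using assms(3) by (auto elim: eventually_mono)
  then have "emeasure M E = 0"
    using assms(1) by (simp add: AE_iff_null_sets null_setsD1)
  then show False
    using assms(2) by simp
qed

section \<open>The Gagliardo seminorm as an integral over pairs\<close>

text \<open>
  The first component of the pair is the variable of the outer integral.
\<close>

definition jump_density :: "real \<Rightarrow> ('a::euclidean_space \<Rightarrow> real) \<Rightarrow> 'a \<times> 'a \<Rightarrow> real" where
  "jump_density \<alpha> u p =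
     \<bar>u (snd p) - u (fst p)\<bar> / norm (snd p - fst p) powr (real DIM('a) + \<alpha>)"

lemma jump_density_nonneg [simp]: "0 \<le> jump_density \<alpha> u p"
  by (simp add: jump_density_def)

lemma measurable_jump_density [measurable]:
  fixes u :: "'a::euclidean_space \<Rightarrow> real"
  assumes [measurable]: "u \<in> borel_measurable borel"
  shows "jump_density \<alpha> u \<in> borel_measurable (lborel \<Otimes>\<^sub>M lborel)"
  unfolding jump_density_def by measurable

lemma gagliardo_eq_pair_integral:
  fixes u :: "'a::euclidean_space \<Rightarrow> real"
  assumes "u \<in> borel_measurable borel"
  shows "gagliardo \<alpha> u = (\<integral>\<^sup>+p. ennreal (jump_density \<alpha> u p) \<partial>(lborel \<Otimes>\<^sub>M lborel))"
proof -
  have "(\<lambda>p. ennreal (jump_density \<alpha> u p)) \<in> borel_measurable (lborel \<Otimes>\<^sub>M lborel)"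
    using assms by measurable
  from lborel.nn_integral_fst[OF this, symmetric] show ?thesis
    by (simp add: gagliardo_def nn_integral_completion jump_density_def)
qed

text \<open>
  The integrand vanishes on the diagonal by the convention for zero denominators, so comparing
  integrands gives nothing there. Each slice of the diagonal is a single point, a null set.
\<close>

lemma AE_lebesgue_pairs:
  assumes "AE p in (lborel :: 'a::euclidean_space measure) \<Otimes>\<^sub>M lborel.
    snd p \<noteq> fst p \<longrightarrow> P (fst p) (snd p)"
  shows "AE y in lebesgue. AE x in lebesgue. P y x"
proof -
  have "AE y in (lborel :: 'a measure). AE x in lborel. x \<noteq> y \<longrightarrow> P y x"
    using lborel_pair.AE_pair[OF assms] by simp
  then have "AE y in (lborel :: 'a measure). AE x in lebesgue. P y x"
  proof eventually_elim
    case (elim y)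
    have "AE x in lborel. x \<noteq> y"
      by (rule AE_lborel_singleton)
    with elim have "AE x in lborel. P y x"
      by eventually_elim simp
    then show ?case
      by (rule AE_completion)
  qed
  then show ?thesis
    by (rule AE_completion)
qed

lemma W_seminorm_scaleR:
  fixes u :: "'a::euclidean_space L1"
  shows "W_seminorm \<alpha> (c *\<^sub>R u) = ennreal \<bar>c\<bar> * W_seminorm \<alpha> u"
proof -
  obtain f where f: "f \<in> borel_measurable borel" "integrable lebesgue f" "u = abs_L1 f"
    by (rule L1_borel_representative)
  have "jump_density \<alpha> (\<lambda>x. c * f x) p = \<bar>c\<bar> * jump_density \<alpha> f p" for p
    by (simp add: jump_density_def abs_mult flip: right_diff_distrib)
  then have "gagliardo \<alpha> (\<lambda>x. c * f x) = ennreal \<bar>c\<bar> * gagliardo \<alpha> f"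
    using f by (simp add: gagliardo_eq_pair_integral ennreal_mult nn_integral_cmult)
  then show ?thesis
    using f by (simp add: W_seminorm_abs_L1 flip: abs_L1_scaleR)
qed

lemma W_seminorm_uminus:
  fixes u :: "'a::euclidean_space L1"
  shows "W_seminorm \<alpha> (- u) = W_seminorm \<alpha> u"
  using W_seminorm_scaleR[of \<alpha> "-1" u] by simp

lemma W_ball_iff: "u \<in> W_ball \<alpha> \<longleftrightarrow> W_seminorm \<alpha> u \<le> 1"
  by (auto simp: W_ball_def W_space_def intro: le_less_trans[of _ 1])

text \<open>
  Both \<open>E\<close> and its complement have positive measure, so each contains a reference point \<open>y\<close>
  with which almost all points of the same set are compared.
\<close>

lemma const_on_and_off_eq_scaled_indicator:
  fixes f :: "'a::euclidean_space \<Rightarrow> real"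
  assumes f: "integrable lebesgue f"
    and E: "E \<in> sets lebesgue" "0 < emeasure lebesgue E" "emeasure lebesgue E < \<infinity>"
    and same: "AE y in lebesgue. AE x in lebesgue. (x \<in> E \<longleftrightarrow> y \<in> E) \<longrightarrow> f x = f y"
  shows "\<exists>c. AE x in lebesgue. f x = c * indicator E x"
proof -
  obtain y where y: "y \<in> E" "AE x in lebesgue. (x \<in> E \<longleftrightarrow> y \<in> E) \<longrightarrow> f x = f y"
    using ex_in_pos_measure_if_AE[OF E(1,2) same] by blast
  have "- E \<in> sets lebesgue"
    using sets.compl_sets[OF E(1)] by (simp add: Compl_eq_Diff_UNIV)
  then obtain z where z: "z \<in> - E" "AE x in lebesgue. (x \<in> E \<longleftrightarrow> z \<in> E) \<longrightarrow> f x = f z"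
    using ex_in_pos_measure_if_AE[OF _ _ same, of "- E"] emeasure_lebesgue_Compl_eq_top[OF E(1,3)]
    by auto
  have "AE x in lebesgue. x \<notin> E \<longrightarrow> f x = f z"
    using z(2) by eventually_elim (use z(1) in simp)
  then have "f z = 0"
    by (rule integrable_const_off_finite_measure_eq_0[OF f E(1,3)])
  with y(1) z(1) have "f x = f y * indicator E x"
    if "(x \<in> E \<longleftrightarrow> y \<in> E) \<longrightarrow> f x = f y" "(x \<in> E \<longleftrightarrow> z \<in> E) \<longrightarrow> f x = f z" for x
    using that by (auto simp: indicator_def)
  with y(2) z(2) have "AE x in lebesgue. f x = f y * indicator E x"
    by (rule eventually_elim2)
  then show ?thesis
    by blast
qed

text \<open>
  A vanishing seminorm makes the function constant, and the only integrable constant is \<open>0\<close>.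
\<close>

lemma gagliardo_eq_0_imp_AE_0:
  fixes f :: "'a::euclidean_space \<Rightarrow> real"
  assumes f: "f \<in> borel_measurable borel" "integrable lebesgue f" and "gagliardo \<alpha> f = 0"
  shows "AE x in lebesgue. f x = 0"
proof -
  have "AE p in lborel \<Otimes>\<^sub>M lborel. jump_density \<alpha> f p = 0"
    using assms by (simp add: gagliardo_eq_pair_integral nn_integral_0_iff_AE
        ennreal_eq_0_iff antisym_conv)
  then have "AE p in lborel \<Otimes>\<^sub>M lborel. snd p \<noteq> fst p \<longrightarrow> f (snd p) = f (fst p)"
    by eventually_elim (auto simp: jump_density_def)
  then have "AE y in lebesgue. AE x in lebesgue. f x = f y"
    by (rule AE_lebesgue_pairs)
  then obtain y where *: "AE x in lebesgue. f x = f y"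
    using ex_in_pos_measure_if_AE[of UNIV lebesgue] by auto
  then have "f y = 0"
    using integrable_const_off_finite_measure_eq_0[OF f(2), of "{}" "f y"] by simp
  with * show ?thesis
    by simp
qed

lemma W_seminorm_eq_0_imp_0:
  fixes u :: "'a::euclidean_space L1"
  assumes "W_seminorm \<alpha> u = 0"
  shows "u = 0"
proof -
  obtain f where f: "f \<in> borel_measurable borel" "integrable lebesgue f" "u = abs_L1 f"
    by (rule L1_borel_representative)
  then have "AE x in lebesgue. f x = 0"
    using assms by (intro gagliardo_eq_0_imp_AE_0[of f \<alpha>]) (simp_all add: W_seminorm_abs_L1)
  then show ?thesis
    using f by (simp add: zero_L1_def abs_L1_eq_iff)
qed

section \<open>Sums of functions and the triangle inequality\<close>

lemma pair_integral_add:
  fixes f g :: "'a::euclidean_space \<Rightarrow> real"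
  assumes "f \<in> borel_measurable borel" "g \<in> borel_measurable borel"
  shows "(\<integral>\<^sup>+p. ennreal (jump_density \<alpha> f p + jump_density \<alpha> g p) \<partial>(lborel \<Otimes>\<^sub>M lborel))
      = gagliardo \<alpha> f + gagliardo \<alpha> g"
  using assms by (simp add: gagliardo_eq_pair_integral ennreal_plus nn_integral_add)

text \<open>
  The triangle inequality is an equality for decompositions whose summands never jump in opposite
  directions. This is the form in which the coarea structure of the seminorm is used.
\<close>

lemma gagliardo_add_of_aligned:
  fixes f g :: "'a::euclidean_space \<Rightarrow> real"
  assumes "f \<in> borel_measurable borel" "g \<in> borel_measurable borel"
    and "\<And>x y. \<bar>(f x + g x) - (f y + g y)\<bar> = \<bar>f x - f y\<bar> + \<bar>g x - g y\<bar>"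
  shows "gagliardo \<alpha> (\<lambda>x. f x + g x) = gagliardo \<alpha> f + gagliardo \<alpha> g"
proof -
  have "jump_density \<alpha> (\<lambda>x. f x + g x) p = jump_density \<alpha> f p + jump_density \<alpha> g p" for p
    by (simp add: jump_density_def assms(3) add_divide_distrib)
  then show ?thesis
    using assms(1,2) by (simp add: gagliardo_eq_pair_integral[of "\<lambda>x. f x + g x"] flip: pair_integral_add)
qed

text \<open>
  Conversely, the integrand of the sum is dominated by the sum of the integrands, so equality of the
  finite integrals forces equality almost everywhere.
\<close>

lemma gagliardo_triangle_equality:
  fixes f g :: "'a::euclidean_space \<Rightarrow> real"
  assumes f: "f \<in> borel_measurable borel" and g: "g \<in> borel_measurable borel"
    and fin: "gagliardo \<alpha> (\<lambda>x. f x + g x) < \<infinity>"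
    and ge: "gagliardo \<alpha> f + gagliardo \<alpha> g \<le> gagliardo \<alpha> (\<lambda>x. f x + g x)"
  shows "AE y in lebesgue. AE x in lebesgue.
    \<bar>(f x + g x) - (f y + g y)\<bar> = \<bar>f x - f y\<bar> + \<bar>g x - g y\<bar>"
proof -
  let ?M = "(lborel :: 'a measure) \<Otimes>\<^sub>M lborel"
  let ?F = "\<lambda>p. ennreal (jump_density \<alpha> (\<lambda>x. f x + g x) p)"
  let ?G = "\<lambda>p. ennreal (jump_density \<alpha> f p + jump_density \<alpha> g p)"
  have FG: "?F p \<le> ?G p" for p
    by (intro ennreal_leI)
      (auto simp: jump_density_def add_divide_distrib[symmetric] intro!: divide_right_mono)
  have F: "gagliardo \<alpha> (\<lambda>x. f x + g x) = (\<integral>\<^sup>+p. ?F p \<partial>?M)"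
    using f g by (simp add: gagliardo_eq_pair_integral)
  have "AE p in ?M. ?G p \<le> ?F p"
  proof (rule ccontr)
    assume "\<not> ?thesis"
    then have "(\<integral>\<^sup>+p. ?F p \<partial>?M) < (\<integral>\<^sup>+p. ?G p \<partial>?M)"
      using f g fin FG by (intro nn_integral_less) (simp_all add: F less_top)
    then have "gagliardo \<alpha> (\<lambda>x. f x + g x) < gagliardo \<alpha> f + gagliardo \<alpha> g"
      by (simp only: F pair_integral_add[OF f g])
    then show False
      using ge by simp
  qed
  then have "AE p in ?M. snd p \<noteq> fst p \<longrightarrow>
      \<bar>(f (snd p) + g (snd p)) - (f (fst p) + g (fst p))\<bar>
        = \<bar>f (snd p) - f (fst p)\<bar> + \<bar>g (snd p) - g (fst p)\<bar>"
  proof eventually_elim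
    case (elim p)
    then have "jump_density \<alpha> f p + jump_density \<alpha> g p \<le> jump_density \<alpha> (\<lambda>x. f x + g x) p"
      by (subst (asm) ennreal_le_iff) simp_all
    then show ?case
      by (auto simp: jump_density_def add_divide_distrib[symmetric] divide_le_cancel)
  qed
  then show ?thesis
    by (rule AE_lebesgue_pairs)
qed

section \<open>A nonzero function of finite seminorm\<close>

text \<open>
  The function is dominated by the sum of \<open>a k\<close> times the indicator of the ball of radius \<open>r k\<close>.
  This replaces integration in polar coordinates.
\<close>

lemma nn_integral_finite_if_dyadic_cover:
  fixes g :: "'a::euclidean_space \<Rightarrow> real"
  assumes cover: "\<And>h. g h \<noteq> 0 \<Longrightarrow> \<exists>k. norm h \<le> r k \<and> g h \<le> a k"
    and nonneg: "\<And>k. 0 \<le> r k" "\<And>k. 0 \<le> a k"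
    and summ: "summable (\<lambda>k. a k * r k ^ DIM('a))"
  shows "(\<integral>\<^sup>+h. ennreal (g h) \<partial>lborel) < \<infinity>"
proof -
  let ?V = "unit_ball_vol (real DIM('a))"
  have [measurable]: "cball (0::'a) (r k) \<in> sets borel" for k
    by simp
  have "ennreal (g h) \<le> (\<Sum>k. ennreal (a k) * indicator (cball 0 (r k)) h)" for h
  proof (cases "g h = 0")
    case False
    then obtain k where k: "norm h \<le> r k" "g h \<le> a k"
      using cover by blast
    have "ennreal (g h) \<le> (\<Sum>k\<in>{k}. ennreal (a k) * indicator (cball 0 (r k)) h)"
      using k by (simp add: ennreal_leI)
    also have "\<dots> \<le> (\<Sum>k. ennreal (a k) * indicator (cball 0 (r k)) h)"
      by (rule sum_le_suminf) auto
    finally show ?thesis .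
  qed simp
  then have "(\<integral>\<^sup>+h. ennreal (g h) \<partial>lborel)
      \<le> (\<integral>\<^sup>+h. (\<Sum>k. ennreal (a k) * indicator (cball 0 (r k)) h) \<partial>(lborel :: 'a measure))"
    by (rule nn_integral_mono)
  also have "\<dots> = (\<Sum>k. \<integral>\<^sup>+h. ennreal (a k) * indicator (cball 0 (r k)) h \<partial>(lborel :: 'a measure))"
    by (rule nn_integral_suminf) measurable
  also have "\<dots> = (\<Sum>k. ennreal (?V * (a k * r k ^ DIM('a))))"
    using nonneg
    by (subst nn_integral_cmult_indicator)
      (simp_all add: emeasure_cball flip: ennreal_mult, simp add: mult_ac)
  also have "\<dots> < \<infinity>"
    using nonneg summ by (simp add: ennreal_suminf_neq_top less_top[symmetric] summable_mult)
  finally show ?thesis .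
qed

lemma ex_dyadic_scale:
  fixes r :: real
  assumes "1 \<le> r"
  shows "\<exists>k. 2 ^ k \<le> r \<and> r \<le> 2 ^ Suc k"
proof -
  define k where "k = nat \<lfloor>log 2 r\<rfloor>"
  have "0 \<le> log 2 r"
    using assms by simp
  then have "real k \<le> log 2 r" "log 2 r \<le> real (Suc k)"
    unfolding k_def by linarith+
  then have "2 powr real k \<le> r" "r \<le> 2 powr real (Suc k)"
    using assms by (simp_all add: le_log_iff log_le_iff)
  then show ?thesis
    by (metis powr_realpow zero_less_numeral)
qed

text \<open>
  The singular kernel times the bound \<open>min 1 (norm h)\<close> for the increment, over a step \<open>h\<close>, of a
  \<open>1\<close>-Lipschitz function with values in the unit interval.
\<close>

definition cutoff_kernel :: "real \<Rightarrow> 'a::euclidean_space \<Rightarrow> real" where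
  "cutoff_kernel \<alpha> h = min 1 (norm h) / norm h powr (real DIM('a) + \<alpha>)"

lemma measurable_cutoff_kernel [measurable]: "cutoff_kernel \<alpha> \<in> borel_measurable borel"
  unfolding cutoff_kernel_def by measurable

lemma cutoff_kernel_nonneg [simp]: "0 \<le> cutoff_kernel \<alpha> h"
  by (simp add: cutoff_kernel_def)

text \<open>
  With \<open>d\<close> the dimension, the kernel is \<open>norm h powr (1 - d - \<alpha>)\<close> in the unit ball and
  \<open>norm h powr (- d - \<alpha>)\<close> outside. On the dyadic shell of radius \<open>2 powr - k\<close> it contributes
  a multiple of \<open>2 powr ((\<alpha> - 1) * k)\<close>, on the shell of radius \<open>2 powr k\<close> a multiple of
  \<open>2 powr (- \<alpha> * k)\<close>. The two geometric series converge because \<open>\<alpha> < 1\<close> and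
  \<open>0 < \<alpha>\<close>, respectively.
\<close>

lemma cutoff_kernel_integral_finite:
  assumes "0 < \<alpha>" "\<alpha> < 1"
  shows "(\<integral>\<^sup>+h. ennreal (cutoff_kernel \<alpha> h) \<partial>(lborel :: 'a::euclidean_space measure)) < \<infinity>"
proof -
  define d where "d = DIM('a)"
  have d: "1 \<le> real d"
    unfolding d_def using DIM_positive[where 'a='a] by linarith
  let ?near = "\<lambda>h::'a. if norm h \<le> 1 then cutoff_kernel \<alpha> h else 0"
  let ?far = "\<lambda>h::'a. if norm h \<le> 1 then 0 else cutoff_kernel \<alpha> h"
  have "(\<integral>\<^sup>+h. ennreal (?near h) \<partial>lborel) < \<infinity>"
  proof (rule nn_integral_finite_if_dyadic_cover
      [where r = "\<lambda>k. 1 / 2 ^ k" and a = "\<lambda>k. (2 ^ Suc k) powr (d + \<alpha> - 1)"])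
    fix h :: 'a
    assume "?near h \<noteq> 0"
    then have h: "0 < norm h" "norm h \<le> 1"
      by (auto simp: cutoff_kernel_def split: if_splits)
    obtain k where k: "2 ^ k \<le> 1 / norm h" "1 / norm h \<le> 2 ^ Suc k"
      using ex_dyadic_scale[of "1 / norm h"] h by (auto simp: field_simps)
    have "?near h = norm h powr 1 / norm h powr (d + \<alpha>)"
      using h by (simp add: cutoff_kernel_def d_def)
    also have "\<dots> = (1 / norm h) powr (d + \<alpha> - 1)"
      using h by (simp add: powr_diff powr_divide)
    also have "\<dots> \<le> (2 ^ Suc k) powr (d + \<alpha> - 1)"
      using k h d assms by (intro powr_mono2) auto
    finally show "\<exists>k. norm h \<le> 1 / 2 ^ k \<and> ?near h \<le> (2 ^ Suc k) powr (d + \<alpha> - 1)"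
      using k h by (intro exI[of _ k]) (auto simp: field_simps)
  next
    have "(2 ^ Suc k) powr (d + \<alpha> - 1) * (1 / 2 ^ k) ^ d
        = 2 powr (d + \<alpha> - 1) * (2 powr (\<alpha> - 1)) ^ k" for k
    proof -
      have "(2 ^ Suc k) powr (d + \<alpha> - 1) * (1 / 2 ^ k) ^ d
          = 2 powr (real (Suc k) * (d + \<alpha> - 1)) * 2 powr (- (real k * d))"
        by (simp add: powr_powr powr_minus powr_realpow[symmetric] divide_simps powr_power
            del: power_Suc of_nat_Suc)
      also have "\<dots> = 2 powr (d + \<alpha> - 1) * 2 powr (real k * (\<alpha> - 1))"
        by (simp add: powr_add[symmetric] algebra_simps)
      finally show ?thesis
        by (simp add: powr_power mult.commute)
    qed
    moreover have "2 powr (\<alpha> - 1) < (1::real)"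
      using assms by (simp add: powr_less_one)
    ultimately show "summable (\<lambda>k. (2 ^ Suc k) powr (d + \<alpha> - 1) * (1 / 2 ^ k) ^ DIM('a))"
      by (simp add: summable_mult summable_geometric flip: d_def)
  qed auto
  moreover have "(\<integral>\<^sup>+h. ennreal (?far h) \<partial>lborel) < \<infinity>"
  proof (rule nn_integral_finite_if_dyadic_cover
      [where r = "\<lambda>k. 2 ^ Suc k" and a = "\<lambda>k. (2 ^ k) powr (- (d + \<alpha>))"])
    fix h :: 'a
    assume "?far h \<noteq> 0"
    then have h: "1 < norm h"
      by (auto split: if_splits)
    obtain k where k: "2 ^ k \<le> norm h" "norm h \<le> 2 ^ Suc k"
      using ex_dyadic_scale[of "norm h"] h by auto
    have "?far h = 1 / norm h powr (d + \<alpha>)"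
      using h by (simp add: cutoff_kernel_def d_def)
    also have "\<dots> = norm h powr (- (d + \<alpha>))"
      by (rule powr_minus_divide[symmetric])
    also have "\<dots> \<le> (2 ^ k) powr (- (d + \<alpha>))"
      using k h d assms by (intro powr_mono2') auto
    finally show "\<exists>k. norm h \<le> 2 ^ Suc k \<and> ?far h \<le> (2 ^ k) powr (- (d + \<alpha>))"
      using k by blast
  next
    have eq: "(2 ^ k) powr (- (d + \<alpha>)) * (2 ^ Suc k) ^ d = 2 ^ d * (2 powr (- \<alpha>)) ^ k" for k
    proof -
      have "(2 ^ k) powr (- (d + \<alpha>)) * (2 ^ Suc k) ^ d
          = 2 powr (real k * - (d + \<alpha>)) * 2 powr (real (Suc k) * d)"
        by (simp add: powr_powr powr_realpow[symmetric] powr_power del: power_Suc of_nat_Suc)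
      also have "\<dots> = 2 powr d * 2 powr (real k * - \<alpha>)"
        by (simp add: powr_add[symmetric] algebra_simps)
      finally show ?thesis
        by (simp add: powr_power powr_realpow mult.commute)
    qed
    have "2 powr (- \<alpha>) < (1::real)"
      using assms by (simp add: powr_less_one)
    then show "summable (\<lambda>k. (2 ^ k) powr (- (d + \<alpha>)) * (2 ^ Suc k) ^ DIM('a))"
      unfolding d_def[symmetric] eq by (simp add: summable_geometric)
  qed auto
  moreover have "(\<integral>\<^sup>+h. ennreal (cutoff_kernel \<alpha> (h::'a)) \<partial>lborel)
      = (\<integral>\<^sup>+h. ennreal (?near h) + ennreal (?far h) \<partial>lborel)"
    by (intro nn_integral_cong) auto
  then have "(\<integral>\<^sup>+h. ennreal (cutoff_kernel \<alpha> (h::'a)) \<partial>lborel)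
      = (\<integral>\<^sup>+h. ennreal (?near h) \<partial>lborel) + (\<integral>\<^sup>+h. ennreal (?far h) \<partial>lborel)"
    by (simp add: nn_integral_add)
  ultimately show ?thesis
    by simp
qed

lemma nn_integral_lborel_translate:
  fixes f :: "'a::euclidean_space \<Rightarrow> ennreal"
  assumes [measurable]: "f \<in> borel_measurable borel"
  shows "(\<integral>\<^sup>+x. f (x - y) \<partial>lborel) = (\<integral>\<^sup>+x. f x \<partial>lborel)"
proof -
  have "(\<integral>\<^sup>+x. f x \<partial>lborel) = (\<integral>\<^sup>+x. f x \<partial>distr lborel borel ((+) (- y)))"
    by (simp add: lborel_distr_plus)
  also have "\<dots> = (\<integral>\<^sup>+x. f (- y + x) \<partial>lborel)"
    by (rule nn_integral_distr) auto
  finally show ?thesis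
    by simp
qed

definition tent :: "'a::euclidean_space \<Rightarrow> real" where
  "tent x = max 0 (1 - norm x)"

lemma measurable_tent [measurable]: "tent \<in> borel_measurable borel"
  unfolding tent_def by measurable

lemma integrable_tent: "integrable lebesgue (tent :: 'a::euclidean_space \<Rightarrow> real)"
proof (rule Bochner_Integration.integrable_bound)
  show "integrable lebesgue (indicator (cball 0 1) :: 'a \<Rightarrow> real)"
    by (simp add: emeasure_cball)
  show "AE x in lebesgue. norm (tent x) \<le> norm (indicator (cball 0 1) x :: real)"
    by (auto simp: tent_def indicator_def)
  show "(tent :: 'a \<Rightarrow> real) \<in> borel_measurable lebesgue"
    by (rule measurable_completion) simp
qed

lemma not_AE_tent_eq_0: "\<not> (AE x in lebesgue. tent (x :: 'a::euclidean_space) = 0)"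
proof
  assume zero: "AE x in lebesgue. tent (x :: 'a) = 0"
  have "0 < emeasure lebesgue (ball (0::'a) 1)"
    by (simp add: emeasure_ball)
  then have "\<exists>x\<in>ball (0::'a) 1. tent x = 0"
    by (rule ex_in_pos_measure_if_AE[rotated, OF _ zero]) simp
  then show False
    by (auto simp: tent_def)
qed

text \<open>
  The increment of the tent between \<open>x\<close> and \<open>y\<close> is at most \<open>min 1 (norm (x - y))\<close>, and it vanishes
  unless one of the two points lies in the unit ball. Integrating first over the other point leaves
  twice the volume of the ball times the integral of the cut-off kernel.
\<close>

lemma gagliardo_tent_finite:
  assumes "0 < \<alpha>" "\<alpha> < 1"
  shows "gagliardo \<alpha> (tent :: 'a::euclidean_space \<Rightarrow> real) < \<infinity>"
proof -
  let ?B = "cball (0::'a) 1"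
  let ?M = "(lborel :: 'a measure) \<Otimes>\<^sub>M lborel"
  define I where "I = (\<integral>\<^sup>+h. ennreal (cutoff_kernel \<alpha> h) \<partial>(lborel :: 'a measure))"
  let ?F = "\<lambda>(y, x). ennreal (cutoff_kernel \<alpha> (x - y)) * indicator ?B y"
  let ?G = "\<lambda>(y, x). ennreal (cutoff_kernel \<alpha> (x - y)) * indicator ?B x"
  have [measurable]: "?B \<in> sets borel"
    by simp
  have fin: "I * emeasure lborel ?B < \<infinity>"
    using cutoff_kernel_integral_finite[OF assms, where 'a='a]
    by (simp add: I_def ennreal_mult_less_top emeasure_cball)
  have meas: "?F \<in> borel_measurable ?M" "?G \<in> borel_measurable ?M"
    unfolding split_beta by measurable
  have slice: "(\<integral>\<^sup>+x. ennreal (cutoff_kernel \<alpha> (x - y)) * indicator ?B y \<partial>lborel)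
      = I * indicator ?B y" for y :: 'a
    using nn_integral_lborel_translate[of "\<lambda>h. ennreal (cutoff_kernel \<alpha> h)" y]
    by (simp add: nn_integral_multc I_def)
  have "cutoff_kernel \<alpha> (y - x) = cutoff_kernel \<alpha> (x - y)" for x y :: 'a
    by (simp add: cutoff_kernel_def norm_minus_commute)
  then have slice': "(\<integral>\<^sup>+x. ennreal (cutoff_kernel \<alpha> (y - x)) * indicator ?B y \<partial>lborel)
      = I * indicator ?B y" for y :: 'a
    unfolding slice[symmetric] by presburger
  have F: "(\<integral>\<^sup>+p. ?F p \<partial>?M) = I * emeasure lborel ?B"
    using lborel.nn_integral_fst[OF meas(1), symmetric]
    by (simp add: slice nn_integral_cmult_indicator)
  have G: "(\<integral>\<^sup>+p. ?G p \<partial>?M) = I * emeasure lborel ?B"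
    using lborel_pair.nn_integral_snd[OF meas(2), symmetric]
    by (simp add: slice' nn_integral_cmult_indicator)
  have "ennreal (jump_density \<alpha> tent p) \<le> ?F p + ?G p" for p :: "'a \<times> 'a"
  proof -
    obtain y x where p: "p = (y, x)"
      by (cases p)
    have "\<bar>tent x - tent y\<bar> \<le> min 1 (norm (x - y)) * (indicator ?B y + indicator ?B x)"
    proof -
      have "\<bar>tent x - tent y\<bar> \<le> norm (x - y)"
        using norm_triangle_ineq3[of x y] by (simp add: tent_def)
      moreover have "0 \<le> tent x" "tent x \<le> 1" "0 \<le> tent y" "tent y \<le> 1"
        by (simp_all add: tent_def)
      ultimately have min: "\<bar>tent x - tent y\<bar> \<le> min 1 (norm (x - y))"
        by simp
      have "z \<notin> ?B \<Longrightarrow> tent z = 0" for z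
        by (simp add: tent_def)
      then consider "tent x = 0" "tent y = 0" | "1 \<le> (indicator ?B y + indicator ?B x :: real)"
        by (cases "x \<in> ?B"; cases "y \<in> ?B") simp_all
      then show ?thesis
      proof cases
        case 2
        then have "min 1 (norm (x - y)) * 1
            \<le> min 1 (norm (x - y)) * (indicator ?B y + indicator ?B x)"
          by (intro mult_left_mono) simp_all
        then show ?thesis
          unfolding mult_1_right by (rule order_trans[OF min])
      qed simp
    qed
    then have "jump_density \<alpha> tent p
        \<le> cutoff_kernel \<alpha> (x - y) * (indicator ?B y + indicator ?B x)"
      by (simp add: p jump_density_def cutoff_kernel_def divide_right_mono)
    then have "ennreal (jump_density \<alpha> tent p)
        \<le> ennreal (cutoff_kernel \<alpha> (x - y) * indicator ?B y + cutoff_kernel \<alpha> (x - y) * indicator ?B x)"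
      by (intro ennreal_leI) (simp add: distrib_left)
    then show ?thesis
      by (simp add: p ennreal_plus ennreal_mult ennreal_indicator)
  qed
  then have "gagliardo \<alpha> (tent :: 'a \<Rightarrow> real) \<le> (\<integral>\<^sup>+p. ?F p + ?G p \<partial>?M)"
    by (simp add: gagliardo_eq_pair_integral nn_integral_mono)
  also have "\<dots> = I * emeasure lborel ?B + I * emeasure lborel ?B"
    using meas by (simp add: nn_integral_add F G)
  also have "\<dots> < \<infinity>"
    using fin by simp
  finally show ?thesis .
qed

lemma ex_nonzero_in_W_ball:
  assumes "0 < \<alpha>" "\<alpha> < 1"
  shows "\<exists>v :: 'a::euclidean_space L1. v \<in> W_ball \<alpha> \<and> v \<noteq> 0"
proof -
  define w where "w = (abs_L1 tent :: 'a L1)"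
  define N where "N = enn2real (W_seminorm \<alpha> w)"
  have "W_seminorm \<alpha> w = ennreal N"
    using gagliardo_tent_finite[OF assms, where 'a='a] integrable_tent[where 'a='a]
    by (simp add: N_def w_def W_seminorm_abs_L1)
  moreover have N: "0 \<le> N"
    by (simp add: N_def)
  ultimately have "W_seminorm \<alpha> ((1 / (N + 1)) *\<^sub>R w) = ennreal (N / (N + 1))"
    by (simp add: W_seminorm_scaleR flip: ennreal_mult)
  moreover have "N / (N + 1) \<le> 1"
    using N by simp
  (* N + 1 is positive even if N = 0. *)
  ultimately have "(1 / (N + 1)) *\<^sub>R w \<in> W_ball \<alpha>"
    using N by (simp add: W_ball_iff)
  moreover have "w \<noteq> 0"
    using not_AE_tent_eq_0[where 'a='a] integrable_tent[where 'a='a]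
    by (simp add: w_def zero_L1_def abs_L1_eq_iff)
  ultimately show ?thesis
    using N by (intro exI[of _ "(1 / (N + 1)) *\<^sub>R w"]) simp
qed

section \<open>Extreme points are multiples of indicators\<close>

text \<open>
  A nonzero point of seminorm \<open>a < 1\<close> lies strictly between \<open>0\<close> and its normalization, at
  parameter \<open>a\<close>. The origin is the midpoint of an antipodal pair, which exists only because the
  ball contains more than the origin.
\<close>

lemma extreme_point_W_seminorm_eq_1:
  fixes u :: "'a::euclidean_space L1"
  assumes \<alpha>: "0 < \<alpha>" "\<alpha> < 1" and u: "u extreme_point_of W_ball \<alpha>"
  shows "W_seminorm \<alpha> u = 1"
proof (rule ccontr)
  assume ne: "W_seminorm \<alpha> u \<noteq> 1"
  define a where "a = enn2real (W_seminorm \<alpha> u)"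
  have le: "W_seminorm \<alpha> u \<le> 1"
    using u by (simp add: extreme_point_of_def W_ball_iff)
  then have "W_seminorm \<alpha> u < \<infinity>"
    by (rule le_less_trans) simp
  then have Wu: "W_seminorm \<alpha> u = ennreal a"
    by (simp add: a_def)
  have a: "0 \<le> a" "a < 1"
    using le ne unfolding Wu by (auto simp: a_def order_less_le)
  have segment: False if "v \<in> W_ball \<alpha>" "w \<in> W_ball \<alpha>" "v \<noteq> w" "0 < t" "t < 1"
    "u = (1 - t) *\<^sub>R v + t *\<^sub>R w" for v w t
    using u that unfolding extreme_point_of_def in_segment by blast
  show False
  proof (cases "a = 0")
    case True
    then have "u = 0"
      using Wu by (simp add: W_seminorm_eq_0_imp_0)
    moreover obtain v :: "'a L1" where v: "v \<in> W_ball \<alpha>" "v \<noteq> 0"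
      using ex_nonzero_in_W_ball[OF \<alpha>] by blast
    moreover have "v \<noteq> - v"
    proof
      assume "v = - v"
      then have "v + v = 0"
        by (simp only: eq_neg_iff_add_eq_0)
      then show False
        using v(2) by (simp flip: scaleR_2)
    qed
    ultimately show False
      by (intro segment[of v "- v" "1 / 2"]) (simp_all add: W_ball_iff W_seminorm_uminus)
  next
    case False
    then have "u \<noteq> 0"
      using Wu a W_seminorm_scaleR[of \<alpha> 0 u] by auto
    moreover have "W_seminorm \<alpha> ((1 / a) *\<^sub>R u) = 1"
      using False a by (simp add: W_seminorm_scaleR Wu flip: ennreal_mult)
    moreover have "W_seminorm \<alpha> (0 :: 'a L1) = 0"
      using W_seminorm_scaleR[of \<alpha> 0 u] by simp
    ultimately show False
      using False a by (intro segment[of 0 "(1 / a) *\<^sub>R u" a]) (simp_all add: W_ball_iff)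
  qed
qed

text \<open>
  If \<open>a\<close> and \<open>b\<close> are the seminorms of \<open>v\<close> and \<open>w\<close>, both positive, then \<open>u\<close> is the convex combination
  of the unit vectors \<open>v / a\<close> and \<open>w / b\<close> with weights \<open>a\<close> and \<open>b\<close>, so these unit vectors agree.
\<close>

lemma extreme_point_summand:
  fixes u v w :: "'a::euclidean_space L1"
  assumes u: "u extreme_point_of W_ball \<alpha>" "W_seminorm \<alpha> u = 1"
    and sum: "u = v + w" "W_seminorm \<alpha> v + W_seminorm \<alpha> w = W_seminorm \<alpha> u"
  shows "\<exists>c. v = c *\<^sub>R u"
proof -
  define a where "a = enn2real (W_seminorm \<alpha> v)"
  define b where "b = enn2real (W_seminorm \<alpha> w)"
  have "W_seminorm \<alpha> v + W_seminorm \<alpha> w < \<infinity>"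
    using u sum by simp
  then have Wv: "W_seminorm \<alpha> v = ennreal a" and Ww: "W_seminorm \<alpha> w = ennreal b"
    by (simp_all add: a_def b_def)
  have nonneg: "0 \<le> a" "0 \<le> b"
    by (simp_all add: a_def b_def)
  have ab: "a + b = 1"
    using sum(2) u(2) nonneg by (simp add: Wv Ww flip: ennreal_plus)
  consider "a = 0" | "b = 0" | "0 < a" "0 < b"
    using nonneg by linarith
  then show ?thesis
  proof cases
    case 1
    then have "v = 0 *\<^sub>R u"
      using Wv by (simp add: W_seminorm_eq_0_imp_0)
    then show ?thesis ..
  next
    case 2
    then have "v = 1 *\<^sub>R u"
      using Ww sum(1) by (simp add: W_seminorm_eq_0_imp_0)
    then show ?thesis ..
  next
    case 3
    have "(1 / a) *\<^sub>R v \<in> W_ball \<alpha>" "(1 / b) *\<^sub>R w \<in> W_ball \<alpha>"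
      using 3 by (simp_all add: W_ball_iff W_seminorm_scaleR Wv Ww flip: ennreal_mult)
    moreover have "u = (1 - b) *\<^sub>R ((1 / a) *\<^sub>R v) + b *\<^sub>R ((1 / b) *\<^sub>R w)"
    proof -
      have "1 - b = a"
        using ab by simp
      then show ?thesis
        using 3 sum(1) by simp
    qed
    moreover have "b < 1"
      using 3 ab by simp
    ultimately have eq: "(1 / a) *\<^sub>R v = (1 / b) *\<^sub>R w"
      using u(1) 3 unfolding extreme_point_of_def in_segment by blast
    have "w = b *\<^sub>R ((1 / b) *\<^sub>R w)"
      using 3 by simp
    also have "\<dots> = (b / a) *\<^sub>R v"
      by (simp flip: eq)
    finally have "a *\<^sub>R u = (a + b) *\<^sub>R v"
      using 3 by (simp add: sum(1) algebra_simps)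
    then have "v = a *\<^sub>R u"
      using ab by simp
    then show ?thesis ..
  qed
qed

text \<open>
  The part of a value below the height \<open>s\<close>, shifted so that \<open>0\<close> is mapped to \<open>0\<close>. It and its
  complement \<open>t - lower_part s t\<close> are both nondecreasing in \<open>t\<close>; the shift keeps compositions
  with integrable functions integrable and lets heights of either sign be treated alike.
\<close>

definition lower_part :: "real \<Rightarrow> real \<Rightarrow> real" where
  "lower_part s t = min t s - min 0 s"

lemma lower_part_aligned:
  "\<bar>(lower_part s a + (a - lower_part s a)) - (lower_part s b + (b - lower_part s b))\<bar>
    = \<bar>lower_part s a - lower_part s b\<bar> + \<bar>(a - lower_part s a) - (b - lower_part s b)\<bar>"
  by (auto simp: lower_part_def min_def)

text \<open>
  For \<open>s \<ge> 0\<close> the cut fixes \<open>a\<close> and lowers \<open>b\<close>, and for \<open>s < 0\<close> it maps \<open>b\<close> to \<open>0\<close> but not \<open>a\<close>.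
  Either way, no common factor \<open>c\<close> fits both values.
\<close>

lemma lower_part_not_proportional:
  assumes "a \<noteq> 0" "b \<noteq> 0" "a < s" "s < b" "lower_part s a = c * a" "lower_part s b = c * b"
  shows False
proof (cases "0 \<le> s")
  case True
  then have "a = c * a" "s = c * b"
    using assms by (simp_all add: lower_part_def)
  then show False
    using assms by simp
next
  case False
  then have "a - s = c * a" "0 = c * b"
    using assms by (simp_all add: lower_part_def)
  then show False
    using assms by simp
qed

lemma extreme_point_proportional_lower_part:
  fixes f :: "'a::euclidean_space \<Rightarrow> real"
  assumes f: "f \<in> borel_measurable borel" "integrable lebesgue f"
    and ext: "abs_L1 f extreme_point_of W_ball \<alpha>" "W_seminorm \<alpha> (abs_L1 f) = 1"
  shows "\<exists>c. AE x in lebesgue. lower_part s (f x) = c * f x"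
proof -
  let ?g = "\<lambda>x. lower_part s (f x)"
  let ?h = "\<lambda>x. f x - lower_part s (f x)"
  have meas: "?g \<in> borel_measurable borel" "?h \<in> borel_measurable borel"
    using f(1) unfolding lower_part_def by measurable
  have gi: "integrable lebesgue ?g"
  proof (rule Bochner_Integration.integrable_bound[OF f(2)])
    show "?g \<in> borel_measurable lebesgue"
      using meas(1) by (intro measurable_completion) simp
    show "AE x in lebesgue. norm (?g x) \<le> norm (f x)"
      by (auto simp: lower_part_def)
  qed
  then have hi: "integrable lebesgue ?h"
    using f(2) by simp
  have "gagliardo \<alpha> (\<lambda>x. ?g x + ?h x) = gagliardo \<alpha> ?g + gagliardo \<alpha> ?h"
    using meas lower_part_aligned by (rule gagliardo_add_of_aligned)
  then have "W_seminorm \<alpha> (abs_L1 ?g) + W_seminorm \<alpha> (abs_L1 ?h) = W_seminorm \<alpha> (abs_L1 f)"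
    using gi hi f(2) by (simp add: W_seminorm_abs_L1)
  moreover have "abs_L1 f = abs_L1 ?g + abs_L1 ?h"
    using gi hi by (simp flip: abs_L1_add)
  ultimately obtain c where "abs_L1 ?g = c *\<^sub>R abs_L1 f"
    using extreme_point_summand[OF ext] by blast
  then have "AE x in lebesgue. ?g x = c * f x"
    using gi f(2) by (simp add: abs_L1_eq_iff flip: abs_L1_scaleR)
  then show ?thesis ..
qed

lemma extreme_point_single_level:
  fixes f :: "'a::euclidean_space \<Rightarrow> real"
  assumes f: "f \<in> borel_measurable borel" "integrable lebesgue f"
    and ext: "abs_L1 f extreme_point_of W_ball \<alpha>" "W_seminorm \<alpha> (abs_L1 f) = 1"
  shows "\<exists>c. c \<noteq> 0 \<and> (AE x in lebesgue. f x = 0 \<or> f x = c)"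
proof -
  have "\<forall>s. \<exists>c. AE x in lebesgue. lower_part s (f x) = c * f x"
    using extreme_point_proportional_lower_part[OF assms] by blast
  then obtain c where c: "\<And>s. AE x in lebesgue. lower_part s (f x) = c s * f x"
    by metis
  (* Only rational heights are cut at, so that one null set serves for all of them. *)
  define good where "good x \<longleftrightarrow> (\<forall>s\<in>\<rat>. lower_part s (f x) = c s * f x)" for x
  have good: "AE x in lebesgue. good x"
    unfolding good_def using c by (simp add: AE_ball_countable countable_rat)
  have no_gap: False if "good x" "good y" "f x \<noteq> 0" "f y \<noteq> 0" "f x < f y" for x y
  proof -
    obtain s where "s \<in> \<rat>" "f x < s" "s < f y"
      using Rats_dense_in_real[OF \<open>f x < f y\<close>] by blast
    then show False
      using lower_part_not_proportional[of "f x" "f y" s "c s"] that by (simp add: good_def)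
  qed
  have "\<not> (AE x in lebesgue. f x = 0)"
  proof
    assume "AE x in lebesgue. f x = 0"
    then have "abs_L1 f = 0"
      using f by (simp add: zero_L1_def abs_L1_eq_iff)
    then show False
      using ext(2) W_seminorm_scaleR[of \<alpha> 0 "abs_L1 f"] by simp
  qed
  then obtain x0 where x0: "good x0" "f x0 \<noteq> 0"
    using good by (metis (mono_tags, lifting) eventually_mono)
  have "AE x in lebesgue. f x = 0 \<or> f x = f x0"
    using good
  proof eventually_elim
    case (elim x)
    then show ?case
      using no_gap[of x x0] no_gap[of x0 x] x0 by force
  qed
  then show ?thesis
    using x0(2) by blast
qed

lemma extreme_point_imp_normalized_indicator:
  fixes u :: "'a::euclidean_space L1"
  assumes \<alpha>: "0 < \<alpha>" "\<alpha> < 1" and u: "u extreme_point_of W_ball \<alpha>"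
  shows "\<exists>E :: 'a set. E \<in> sets lebesgue \<and>
          0 < emeasure lebesgue E \<and> emeasure lebesgue E < \<infinity> \<and>
          0 < frac_perimeter \<alpha> E \<and> frac_perimeter \<alpha> E < \<infinity> \<and>
          (u = abs_L1 (\<lambda>x. indicator E x / enn2real (frac_perimeter \<alpha> E)) \<or>
           u = - abs_L1 (\<lambda>x. indicator E x / enn2real (frac_perimeter \<alpha> E)))"
proof -
  obtain f where f: "f \<in> borel_measurable borel" "integrable lebesgue f" "u = abs_L1 f"
    by (rule L1_borel_representative)
  have Wu: "W_seminorm \<alpha> u = 1"
    using \<alpha> u by (rule extreme_point_W_seminorm_eq_1)
  obtain c where c: "c \<noteq> 0" "AE x in lebesgue. f x = 0 \<or> f x = c"
    using extreme_point_single_level[of f \<alpha>] f u Wu by blast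
  define E where "E = {x. f x = c}"
  have "E \<in> sets borel"
    using f(1) unfolding E_def by measurable
  then have E: "E \<in> sets lebesgue"
    by simp
  have fE: "AE x in lebesgue. f x = c * indicator E x"
    using c(2) by eventually_elim (auto simp: E_def indicator_def)
  have "integrable lebesgue (\<lambda>x. c * indicator E x :: real)"
    using E fE by (intro integrable_cong_AE_imp[OF f(2)]) auto
  then have Ei: "integrable lebesgue (indicator E :: 'a \<Rightarrow> real)"
    using c(1) by simp
  have uE: "u = c *\<^sub>R abs_L1 (indicator E)"
    using fE f Ei by (simp add: abs_L1_eq_iff flip: abs_L1_scaleR)
  define P where "P = frac_perimeter \<alpha> E"
  have "ennreal \<bar>c\<bar> * P = 1"
    using Wu Ei by (simp add: uE W_seminorm_scaleR W_seminorm_abs_L1 P_def frac_perimeter_def)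
  moreover from this have "P \<noteq> \<infinity>" "P \<noteq> 0"
    using c(1) by (auto simp: ennreal_mult_top)
  ultimately have P: "P = ennreal (1 / \<bar>c\<bar>)" 
    using c(1) by (cases P) (auto simp: field_simps simp flip: ennreal_mult)
  have "abs_L1 (\<lambda>x. indicator E x / enn2real P) = abs_L1 (\<lambda>x. \<bar>c\<bar> * indicator E x)"
    by (simp add: P mult.commute)
  also have "\<dots> = \<bar>c\<bar> *\<^sub>R abs_L1 (indicator E)"
    using Ei by (rule abs_L1_scaleR)
  finally have "u = abs_L1 (\<lambda>x. indicator E x / enn2real P) \<or>
      u = - abs_L1 (\<lambda>x. indicator E x / enn2real P)"
    using uE by (cases "0 \<le> c") auto
  moreover have "emeasure lebesgue E \<noteq> 0"
  proof
    assume "emeasure lebesgue E = 0"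
    then have "AE x in lebesgue. x \<notin> E"
      using E by (intro AE_not_in null_setsI)
    then have "abs_L1 (indicator E) = (0 :: 'a L1)"
      using Ei by (auto simp: zero_L1_def abs_L1_eq_iff elim: eventually_mono)
    then show False
      using Wu uE W_seminorm_scaleR[of \<alpha> 0 u] by simp
  qed
  moreover have "emeasure lebesgue E < \<infinity>"
    using Ei E by (simp add: integrable_indicator_iff)
  moreover have "0 < P" "P < \<infinity>"
    using P c(1) by simp_all
  ultimately show ?thesis
    using E unfolding P_def by (auto simp: zero_less_iff_neq_zero)
qed

section \<open>Normalized indicators are extreme points\<close>

text \<open>
  Equality in the triangle inequality says that \<open>v\<close> does not jump between points where the
  indicator does not jump.
\<close>

lemma convex_combination_of_indicator:
  fixes v w :: "'a::euclidean_space L1"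
  assumes E: "E \<in> sets lebesgue" "0 < emeasure lebesgue E" "emeasure lebesgue E < \<infinity>"
    and t: "0 < t" "t < 1"
    and vw: "v \<in> W_ball \<alpha>" "w \<in> W_ball \<alpha>"
    and u: "c *\<^sub>R abs_L1 (indicator E) = (1 - t) *\<^sub>R v + t *\<^sub>R w"
      "W_seminorm \<alpha> (c *\<^sub>R abs_L1 (indicator E)) = 1"
  shows "\<exists>b. v = b *\<^sub>R (c *\<^sub>R abs_L1 (indicator E))"
proof -
  obtain f where f: "f \<in> borel_measurable borel" "integrable lebesgue f" "v = abs_L1 f"
    by (rule L1_borel_representative)
  obtain g where g: "g \<in> borel_measurable borel" "integrable lebesgue g" "w = abs_L1 g"
    by (rule L1_borel_representative)
  let ?f = "\<lambda>x. (1 - t) * f x"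
  let ?g = "\<lambda>x. t * g x"
  have fi: "integrable lebesgue ?f" and gi: "integrable lebesgue ?g"
    using f g by simp_all
  have Ei: "integrable lebesgue (indicator E :: 'a \<Rightarrow> real)"
    using E by (simp add: integrable_indicator_iff)
  have c: "c \<noteq> 0"
    using u(2) W_seminorm_scaleR[of \<alpha> 0 v] by auto
  have sum: "c *\<^sub>R abs_L1 (indicator E) = abs_L1 (\<lambda>x. ?f x + ?g x)"
    using fi gi f g by (simp add: u(1) abs_L1_add abs_L1_scaleR)
  then have eq: "AE x in lebesgue. c * indicator E x = ?f x + ?g x"
    using fi gi Ei by (simp add: abs_L1_eq_iff flip: abs_L1_scaleR)
  have one: "gagliardo \<alpha> (\<lambda>x. ?f x + ?g x) = 1"
    using sum u(2) fi gi by (simp add: W_seminorm_abs_L1)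
  have "gagliardo \<alpha> ?f = ennreal (1 - t) * W_seminorm \<alpha> v"
    using fi f t by (simp add: abs_L1_scaleR W_seminorm_scaleR flip: W_seminorm_abs_L1)
  moreover have "gagliardo \<alpha> ?g = ennreal t * W_seminorm \<alpha> w"
    using gi g t by (simp add: abs_L1_scaleR W_seminorm_scaleR flip: W_seminorm_abs_L1)
  ultimately have "gagliardo \<alpha> ?f + gagliardo \<alpha> ?g \<le> ennreal (1 - t) * 1 + ennreal t * 1"
    using vw by (auto simp only: W_ball_iff zero_le intro!: add_mono mult_left_mono)
  also have "\<dots> = 1"
    using t by (simp flip: ennreal_plus)
  finally have "AE y in lebesgue. AE x in lebesgue.
      \<bar>(?f x + ?g x) - (?f y + ?g y)\<bar> = \<bar>?f x - ?f y\<bar> + \<bar>?g x - ?g y\<bar>"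
    using f(1) g(1) one by (intro gagliardo_triangle_equality[where \<alpha> = \<alpha>]) simp_all
  then have "AE y in lebesgue. AE x in lebesgue. (x \<in> E \<longleftrightarrow> y \<in> E) \<longrightarrow> f x = f y"
    using eq
  proof eventually_elim
    case (elim y)
    note y = elim(2)
    from elim(1) eq show ?case
    proof eventually_elim
      case (elim x)
      show ?case
      proof
        assume "x \<in> E \<longleftrightarrow> y \<in> E"
        then have "?f x + ?g x = ?f y + ?g y"
          using elim(2) y by (simp add: indicator_def)
        then have "\<bar>?f x - ?f y\<bar> = 0"
          using elim(1) by linarith
        then show "f x = f y"
          using t by simp
      qed
    qed
  qed
  then obtain b where b: "AE x in lebesgue. f x = b * indicator E x"
    using const_on_and_off_eq_scaled_indicator[OF f(2) E] by blast
  then have "v = b *\<^sub>R abs_L1 (indicator E)"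
    using f Ei by (simp add: abs_L1_eq_iff flip: abs_L1_scaleR)
  then have "v = (b / c) *\<^sub>R (c *\<^sub>R abs_L1 (indicator E))"
    using c by simp
  then show ?thesis ..
qed

text \<open>
  Both ends of the segment are multiples \<open>a\<close> and \<open>b\<close> of \<open>u\<close>, with \<open>a, b \<le> 1\<close>
  since they lie in the ball. The weighted mean of \<open>a\<close> and \<open>b\<close> is \<open>1\<close>, so \<open>a = b = 1\<close>
  and the segment is degenerate.
\<close>

lemma normalized_indicator_extreme_point:
  fixes E :: "'a::euclidean_space set"
  assumes E: "E \<in> sets lebesgue" "0 < emeasure lebesgue E" "emeasure lebesgue E < \<infinity>"
    and W: "W_seminorm \<alpha> (c *\<^sub>R abs_L1 (indicator E)) = 1"
  shows "c *\<^sub>R abs_L1 (indicator E) extreme_point_of W_ball \<alpha>"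
proof -
  define u :: "'a L1" where "u = c *\<^sub>R abs_L1 (indicator E)"
  have Wu: "W_seminorm \<alpha> u = 1"
    using W by (simp add: u_def)
  then have u0: "u \<noteq> 0"
    using W_seminorm_scaleR[of \<alpha> 0 u] by auto
  have False if vw: "v \<in> W_ball \<alpha>" "w \<in> W_ball \<alpha>" "v \<noteq> w"
    and t: "0 < t" "t < 1" and eq: "u = (1 - t) *\<^sub>R v + t *\<^sub>R w" for v w t
  proof -
    obtain a where a: "v = a *\<^sub>R u"
      using convex_combination_of_indicator[OF E t vw(1,2)] eq Wu unfolding u_def by blast
    have "u = (1 - (1 - t)) *\<^sub>R w + (1 - t) *\<^sub>R v"
      using eq by (simp add: add.commute)
    then obtain b where b: "w = b *\<^sub>R u"
      using convex_combination_of_indicator[OF E _ _ vw(2,1), of "1 - t"] t Wu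
      unfolding u_def by auto
    have "\<bar>a\<bar> \<le> 1" "\<bar>b\<bar> \<le> 1"
      using vw Wu by (simp_all add: a b W_ball_iff W_seminorm_scaleR)
    then have ab: "a \<le> 1" "b \<le> 1"
      by linarith+
    have "1 *\<^sub>R u = ((1 - t) * a + t * b) *\<^sub>R u"
      using eq by (simp add: a b scaleR_left_distrib)
    then have "1 = (1 - t) * a + t * b"
      using u0 by (simp only: scaleR_cancel_right) simp
    then have "(1 - t) * (1 - a) + t * (1 - b) = 0"
      by (simp add: algebra_simps)
    moreover have "0 \<le> (1 - t) * (1 - a)" "0 \<le> t * (1 - b)"
      using t ab by simp_all
    ultimately have "(1 - t) * (1 - a) = 0" "t * (1 - b) = 0"
      by linarith+
    then show False
      using t vw(3) by (simp add: a b)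
  qed
  moreover have "u \<in> W_ball \<alpha>"
    using Wu by (simp add: W_ball_iff)
  ultimately show ?thesis
    unfolding u_def[symmetric] extreme_point_of_def in_segment by blast
qed

theorem theorem2p20:
  fixes \<alpha> :: real
  assumes "0 < \<alpha>" and "\<alpha> < 1"
  shows "{u :: (real ^ 'n) L1. u extreme_point_of W_ball \<alpha>} =
    {u. \<exists>E :: (real ^ 'n) set. E \<in> sets lebesgue \<and>
          0 < emeasure lebesgue E \<and> emeasure lebesgue E < \<infinity> \<and>
          0 < frac_perimeter \<alpha> E \<and> frac_perimeter \<alpha> E < \<infinity> \<and>
          (u = abs_L1 (\<lambda>x. indicator E x / enn2real (frac_perimeter \<alpha> E)) \<or>
           u = - abs_L1 (\<lambda>x. indicator E x / enn2real (frac_perimeter \<alpha> E)))}"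
proof (rule Collect_cong, rule iffI)
  fix u :: "(real ^ 'n) L1"
  assume "u extreme_point_of W_ball \<alpha>"
  then show "\<exists>E :: (real ^ 'n) set. E \<in> sets lebesgue \<and>
          0 < emeasure lebesgue E \<and> emeasure lebesgue E < \<infinity> \<and>
          0 < frac_perimeter \<alpha> E \<and> frac_perimeter \<alpha> E < \<infinity> \<and>
          (u = abs_L1 (\<lambda>x. indicator E x / enn2real (frac_perimeter \<alpha> E)) \<or>
           u = - abs_L1 (\<lambda>x. indicator E x / enn2real (frac_perimeter \<alpha> E)))"
    by (rule extreme_point_imp_normalized_indicator[OF assms])
next
  fix u :: "(real ^ 'n) L1"
  assume "\<exists>E :: (real ^ 'n) set. E \<in> sets lebesgue \<and>
          0 < emeasure lebesgue E \<and> emeasure lebesgue E < \<infinity> \<and>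
          0 < frac_perimeter \<alpha> E \<and> frac_perimeter \<alpha> E < \<infinity> \<and>
          (u = abs_L1 (\<lambda>x. indicator E x / enn2real (frac_perimeter \<alpha> E)) \<or>
           u = - abs_L1 (\<lambda>x. indicator E x / enn2real (frac_perimeter \<alpha> E)))"
  then obtain E :: "(real ^ 'n) set" where
    E: "E \<in> sets lebesgue" "0 < emeasure lebesgue E" "emeasure lebesgue E < \<infinity>"
    and P: "0 < frac_perimeter \<alpha> E" "frac_perimeter \<alpha> E < \<infinity>"
    and u: "u = abs_L1 (\<lambda>x. indicator E x / enn2real (frac_perimeter \<alpha> E)) \<or>
           u = - abs_L1 (\<lambda>x. indicator E x / enn2real (frac_perimeter \<alpha> E))"
    by blast
  define p where "p = enn2real (frac_perimeter \<alpha> E)"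
  have p: "0 < p" "frac_perimeter \<alpha> E = ennreal p"
    using P by (simp_all add: p_def enn2real_positive_iff)
  have Ei: "integrable lebesgue (indicator E :: real ^ 'n \<Rightarrow> real)"
    using E by (simp add: integrable_indicator_iff)
  have "abs_L1 (\<lambda>x. indicator E x / p) = (1 / p) *\<^sub>R abs_L1 (indicator E)"
    using abs_L1_scaleR[OF Ei, of "1 / p"] by simp
  then have "u = (1 / p) *\<^sub>R abs_L1 (indicator E) \<or> u = (- (1 / p)) *\<^sub>R abs_L1 (indicator E)"
    using u unfolding p_def[symmetric] by (simp only: scaleR_minus_left)
  moreover have "\<bar>1 / p\<bar> = 1 / p" "\<bar>- (1 / p)\<bar> = 1 / p"
    using p(1) by simp_all
  ultimately obtain c where c: "\<bar>c\<bar> = 1 / p" "u = c *\<^sub>R abs_L1 (indicator E)"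
    by blast
  have "W_seminorm \<alpha> (abs_L1 (indicator E)) = ennreal p"
    using Ei p(2) by (simp add: W_seminorm_abs_L1 frac_perimeter_def)
  then have "W_seminorm \<alpha> (c *\<^sub>R abs_L1 (indicator E)) = 1"
    using p(1) by (simp add: W_seminorm_scaleR c(1) flip: ennreal_mult)
  then show "u extreme_point_of W_ball \<alpha>"
    unfolding c(2) by (rule normalized_indicator_extreme_point[OF E])
qed

end
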